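(* Let $E$ be a finite nonempty set. (i) Every CAR mechanism on $E$ can be arbitrarily well approximated by a rational CAR mechanism: for every CAR mechanism $\boldsymbol{\pi}$ on $E$ and every $\varepsilon>0$ there exists a rational CAR mechanism $\boldsymbol{\pi}'$ on $E$ such that $\|\boldsymbol{\pi}-\boldsymbol{\pi}'\|<\varepsilon$. (ii) Every CAR mechanism on $E$ is exactly equal to a finite mixture of extreme (and hence rational) CAR mechanisms on $E$. That is, every extreme CAR mechanism is rational, and for every CAR mechanism $\boldsymbol{\pi}$ there exist $p\ge1$, extreme CAR mechanisms $\boldsymbol{\pi}_1,\ldots,\boldsymbol{\pi}_p$ and a probability vector $(\lambda_1,\ldots,\lambda_p)$ with $\boldsymbol{\pi}=\sum_{i=1}^p\lambda_i\boldsymbol{\pi}_i$.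
   Context: Let $E$ be a finite nonempty set with $n$ elements. A CAR (coarsening at random) mechanism on $E$ is a vector of real numbers $\boldsymbol{\pi}=(\pi_A:\varnothing\neq A\subseteq E)$, indexed by the nonempty subsets of $E$, such that $\pi_A\ge 0$ for all $A$ and $\sum_{A\ni x}\pi_A=1$ for every $x\in E$. Here $\|\cdot\|$ is the Euclidean norm on $\mathbb{R}^{2^n-1}$ (any norm gives an equivalent statement). A CAR mechanism is called rational if all $\pi_A$ are rational numbers. Equivalently, it is generated by a uniform multicover: there are an integer $k\ge1$ and nonnegative integers $n_A$ ($\varnothing\ne A\subseteq E$) with $\sum_{A\ni x}n_A=k$ for every $x\in E$, such that $\pi_A=n_A/k$ for all $A$. A cover of $E$ is a collection $(A_1,\ldots,A_m)$ of distinct nonempty subsets of $E$ whose union is $E$. Its incidence matrix $M$ is the matrix with rows indexed by $x\in E$, columns indexed by $j=1,\ldots,m$, and entries $1$ if $x\in A_j$ and $0$ otherwise. If $M\mathbf{z}=\mathbf{1}$ (with $\mathbf{1}$ the all-ones vector) has a nonnegative solution $\mathbf{z}=(z_1,\ldots,z_m)$, the CAR mechanism corresponding to it is given by $\pi_{A_j}=z_j$ for $j=1,\ldots,m$ and $\pi_A=0$ for every $A$ not in the cover. A CAR mechanism $\boldsymbol{\pi}$ is called extreme if it corresponds to the incidence matrix $M$ of a cover $(A_1,\ldots,A_m)$ of $E$ such that the equation $M\mathbf{z}=\mathbf{1}$ has a unique solution $\mathbf{z}\in\mathbb{R}^m$, and this solution is strictly positive (all $z_j>0$). *)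

theory Defs
  imports "HOL-Analysis.Analysis"
begin

text \<open>
  A real vector indexed by a set \<open>I\<close> is an element of \<open>I \<rightarrow>\<^sub>E UNIV\<close>, that is, a function pinned to
  \<open>undefined\<close> outside \<open>I\<close>. Equality of such functions is therefore equality of vectors. The
  Euclidean norm of the vector \<open>v\<close> is \<open>L2_set v I\<close>.
\<close>

definition nonempty_subsets :: "'a set \<Rightarrow> 'a set set" where
  "nonempty_subsets E = {A. A \<subseteq> E \<and> A \<noteq> {}}"

definition CAR_mechanism :: "'a set \<Rightarrow> ('a set \<Rightarrow> real) \<Rightarrow> bool" where
  "CAR_mechanism E \<pi> \<longleftrightarrow>
     \<pi> \<in> nonempty_subsets E \<rightarrow>\<^sub>E UNIV \<and>
     (\<forall>A\<in>nonempty_subsets E. 0 \<le> \<pi> A) \<and>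
     (\<forall>x\<in>E. (\<Sum>A | A \<in> nonempty_subsets E \<and> x \<in> A. \<pi> A) = 1)"

definition rational_CAR :: "'a set \<Rightarrow> ('a set \<Rightarrow> real) \<Rightarrow> bool" where
  "rational_CAR E \<pi> \<longleftrightarrow>
     CAR_mechanism E \<pi> \<and> (\<forall>A\<in>nonempty_subsets E. \<pi> A \<in> \<rat>)"

definition is_cover :: "'a set \<Rightarrow> 'a set list \<Rightarrow> bool" where
  "is_cover E As \<longleftrightarrow>
     distinct As \<and> set As \<subseteq> nonempty_subsets E \<and> \<Union>(set As) = E"

text \<open>Columns are numbered from \<open>0\<close>, following the indexing of lists.\<close>

definition incidence :: "'a set list \<Rightarrow> 'a \<Rightarrow> nat \<Rightarrow> real" where
  "incidence As x j = (if x \<in> As ! j then 1 else 0)"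

text \<open>The solutions in \<open>\<real>\<^sup>m\<close> of \<open>M z = 1\<close>, where \<open>M\<close> is the incidence matrix and
  \<open>m = length As\<close>.\<close>

definition cover_solutions :: "'a set \<Rightarrow> 'a set list \<Rightarrow> (nat \<Rightarrow> real) set" where
  "cover_solutions E As =
     {z \<in> {..<length As} \<rightarrow>\<^sub>E UNIV. \<forall>x\<in>E. (\<Sum>j<length As. incidence As x j * z j) = 1}"

definition corresponds_to ::
    "'a set \<Rightarrow> ('a set \<Rightarrow> real) \<Rightarrow> 'a set list \<Rightarrow> (nat \<Rightarrow> real) \<Rightarrow> bool" where
  "corresponds_to E \<pi> As z \<longleftrightarrow>
     (\<forall>j<length As. \<pi> (As ! j) = z j) \<and>
     (\<forall>A\<in>nonempty_subsets E. A \<notin> set As \<longrightarrow> \<pi> A = 0)"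

definition extreme_CAR :: "'a set \<Rightarrow> ('a set \<Rightarrow> real) \<Rightarrow> bool" where
  "extreme_CAR E \<pi> \<longleftrightarrow>
     CAR_mechanism E \<pi> \<and>
     (\<exists>As z. is_cover E As \<and> cover_solutions E As = {z} \<and>
        (\<forall>j<length As. 0 < z j) \<and> corresponds_to E \<pi> As z)"

end

theory Submission
  imports Defs
begin

text \<open>
  The mechanisms form a polytope. A mechanism \<open>\<pi>\<close> is extreme as soon as no nonzero \<open>d\<close> supported where
  \<open>\<pi>\<close> is positive has all sums \<open>\<Sum>A\<ni>x. d A\<close> equal to \<open>0\<close>; otherwise \<open>\<pi>\<close> lies strictly between two
  mechanisms \<open>\<pi> + t d\<close> and \<open>\<pi> - s d\<close> of smaller support, and induction on the support gives the mixture.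
  An extreme mechanism is rational because a \<open>\<rat>\<close>-linear retraction \<open>\<real> \<rightarrow> \<rat>\<close> maps the solution of
  \<open>M z = 1\<close> to a rational solution, which by uniqueness is the same. Rounding the weights of the mixture
  then gives rational approximations.
\<close>

lemma finite_nonempty_subsets: "finite E \<Longrightarrow> finite (nonempty_subsets E)"
  unfolding nonempty_subsets_def by simp

subsection \<open>Extreme mechanisms\<close>

text \<open>Bridge between the two indexings: row \<open>x\<close> of the matrix applied to a column
  vector becomes a sum over the sets containing \<open>x\<close>, once the vector is extended by 0
  to the sets outside the cover.\<close>

lemma sum_incidence:
  assumes "finite E" "distinct As" "set As \<subseteq> nonempty_subsets E"
  shows "(\<Sum>j<length As. incidence As x j * g (As ! j)) =
    (\<Sum>A | A \<in> nonempty_subsets E \<and> x \<in> A. if A \<in> set As then g A else 0)"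
proof -
  have "bij_betw (\<lambda>j. As ! j) {..<length As} (set As)"
    using assms(2) by (simp add: bij_betw_nth)
  then have "(\<Sum>j<length As. incidence As x j * g (As ! j)) =
      (\<Sum>A\<in>set As. (if x \<in> A then 1 else 0) * g A)"
    by (subst sum.reindex_bij_betw[symmetric]) (auto simp: incidence_def)
  also have "\<dots> = (\<Sum>A\<in>{A \<in> set As. x \<in> A}. g A)"
    by (simp add: sum.If_cases Int_def if_distrib[of "\<lambda>u. u * _"] cong: if_cong)
  also have "\<dots> = (\<Sum>A | A \<in> nonempty_subsets E \<and> x \<in> A. if A \<in> set As then g A else 0)"
    using finite_nonempty_subsets[OF assms(1)] assms(3)
    by (intro sum.mono_neutral_cong_left) auto
  finally show ?thesis .
qed

text \<open>The witnessing cover is the support of \<open>\<pi>\<close>, listed in any order; it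
  reaches every \<open>x\<close> because the sum at \<open>x\<close> is 1 and so has a nonzero term.
  Two solutions of the system differ by a kernel vector supported where \<open>\<pi>\<close> is
  positive, so a trivial kernel yields uniqueness.\<close>

lemma extreme_CAR_if_trivial_kernel:
  assumes "finite E" and car: "CAR_mechanism E \<pi>"
    and kernel: "\<And>d :: 'a set \<Rightarrow> real.
      (\<And>x. x \<in> E \<Longrightarrow> (\<Sum>A | A \<in> nonempty_subsets E \<and> x \<in> A. d A) = 0) \<Longrightarrow>
      (\<And>A. \<pi> A = 0 \<Longrightarrow> d A = 0) \<Longrightarrow> \<forall>A\<in>nonempty_subsets E. d A = 0"
  shows "extreme_CAR E \<pi>"
proof -
  define S where "S = {A \<in> nonempty_subsets E. \<pi> A \<noteq> 0}"
  have "finite S"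
    using finite_nonempty_subsets[OF assms(1)] by (simp add: S_def)
  then obtain As where As: "set As = S" "distinct As"
    using finite_distinct_list by blast
  have sub: "set As \<subseteq> nonempty_subsets E"
    using As by (auto simp: S_def)
  have total: "(\<Sum>A | A \<in> nonempty_subsets E \<and> x \<in> A. \<pi> A) = 1" if "x \<in> E" for x
    using car that by (simp add: CAR_mechanism_def)
  have cover: "is_cover E As"
    unfolding is_cover_def
  proof (intro conjI equalityI subsetI)
    fix x assume "x \<in> E"
    then have "(\<Sum>A | A \<in> nonempty_subsets E \<and> x \<in> A. \<pi> A) \<noteq> 0"
      by (simp add: total)
    then obtain A where "A \<in> nonempty_subsets E" "x \<in> A" "\<pi> A \<noteq> 0"
      by (metis (mono_tags, lifting) mem_Collect_eq sum.not_neutral_contains_not_neutral)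
    then show "x \<in> \<Union> (set As)"
      by (auto simp: As S_def)
  qed (use As sub in \<open>auto simp: nonempty_subsets_def\<close>)
  define z where "z = (\<lambda>j\<in>{..<length As}. \<pi> (As ! j))"
  have "z \<in> cover_solutions E As"
  proof -
    have "(\<Sum>j<length As. incidence As x j * z j) = 1" if "x \<in> E" for x
    proof -
      have "(\<Sum>j<length As. incidence As x j * z j) = (\<Sum>j<length As. incidence As x j * \<pi> (As ! j))"
        by (simp add: z_def)
      also have "\<dots> = (\<Sum>A | A \<in> nonempty_subsets E \<and> x \<in> A. \<pi> A)"
        unfolding sum_incidence[OF assms(1) As(2) sub]
        by (intro sum.cong) (auto simp: As S_def)
      finally show ?thesis
        using total that by simp
    qed
    then show ?thesis
      by (simp add: cover_solutions_def z_def)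
  qed
  moreover have "y = z" if y: "y \<in> cover_solutions E As" for y
  proof -
    \<comment> \<open>\<open>idx\<close> recovers the column number from a set, so that the solution
      \<open>y\<close>, indexed by columns, can be turned into a function \<open>d\<close> on sets
      to which \<open>kernel\<close> applies.\<close>
    define idx where "idx = inv_into {..<length As} (\<lambda>j. As ! j)"
    have idx: "idx (As ! j) = j" if "j < length As" for j
      using that As(2) unfolding idx_def by (intro inv_into_f_f) (auto simp: inj_on_def nth_eq_iff_index_eq)
    define d where "d A = (if A \<in> set As then y (idx A) - \<pi> A else 0)" for A
    have "\<forall>A\<in>nonempty_subsets E. d A = 0"
    proof (rule kernel)
      fix x assume x: "x \<in> E"
      have "(\<Sum>A | A \<in> nonempty_subsets E \<and> x \<in> A. d A) =
          (\<Sum>j<length As. incidence As x j * (y (idx (As ! j)) - \<pi> (As ! j)))"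
        unfolding d_def by (rule sum_incidence[OF assms(1) As(2) sub, symmetric])
      also have "\<dots> = (\<Sum>j<length As. incidence As x j * y j) - (\<Sum>j<length As. incidence As x j * z j)"
        by (simp add: idx z_def sum_subtractf right_diff_distrib)
      also have "\<dots> = 0"
        using y \<open>z \<in> cover_solutions E As\<close> x by (simp add: cover_solutions_def)
      finally show "(\<Sum>A | A \<in> nonempty_subsets E \<and> x \<in> A. d A) = 0" .
    next
      show "d A = 0" if "\<pi> A = 0" for A
        using that by (auto simp: d_def As S_def)
    qed
    then have "d (As ! j) = 0" if "j < length As" for j
      using that sub nth_mem by blast
    then have "y j = z j" if "j < length As" for j
      using that by (fastforce simp: d_def idx z_def)
    then show ?thesis
      using y by (intro PiE_ext[where k = "{..<length As}"]) (auto simp: cover_solutions_def z_def)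
  qed
  ultimately have "cover_solutions E As = {z}"
    by blast
  moreover have "\<forall>j<length As. 0 < z j"
  proof (intro allI impI)
    fix j assume j: "j < length As"
    then have "As ! j \<in> S"
      using As nth_mem by blast
    then show "0 < z j"
      using j car by (fastforce simp: z_def S_def CAR_mechanism_def)
  qed
  moreover have "corresponds_to E \<pi> As z"
    by (auto simp: corresponds_to_def z_def As S_def)
  ultimately show ?thesis
    using car cover unfolding extreme_CAR_def by blast
qed

section \<open>Rationality of extreme mechanisms\<close>

text \<open>View the reals as a vector space over the rationals. Since 1 is independent there, the
  assignment of 1 to 1 extends to a linear functional with rational values.\<close>

lemma rational_retraction:
  obtains f :: "real \<Rightarrow> real" where "Modules.additive f" "f 1 = 1" "range f \<subseteq> \<rat>"
proof -
  interpret vector_space_pair "\<lambda>(q::rat) (r::real). of_rat q * r" "(*) :: rat \<Rightarrow> rat \<Rightarrow> rat"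
    by unfold_locales (simp_all add: algebra_simps of_rat_add of_rat_mult)
  have "vs1.independent {1}"
    by (simp add: vs1.dependent_single)
  then obtain g where g: "Vector_Spaces.linear (\<lambda>(q::rat) (r::real). of_rat q * r) ((*)) g" "g 1 = 1"
    using linear_independent_extend[of "{1}" "\<lambda>_. 1"] by auto
  show ?thesis
  proof
    show "Modules.additive (\<lambda>x. of_rat (g x) :: real)"
      using linear_add[OF g(1)] by unfold_locales (simp add: of_rat_add)
  qed (use g in auto)
qed

text \<open>All matrix entries are 0 or 1, so an additive \<open>f\<close> with
  \<open>f 1 = 1\<close> maps solutions to solutions. Uniqueness is over all real vectors, hence
  applies to the image without knowing its signs and forces \<open>z\<close> to be fixed by
  \<open>f\<close>.\<close>

lemma extreme_CAR_imp_rational: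
  assumes "extreme_CAR E \<pi>"
  shows "rational_CAR E \<pi>"
proof -
  obtain As z where As: "cover_solutions E As = {z}" "corresponds_to E \<pi> As z"
    using assms by (auto simp: extreme_CAR_def)
  obtain f :: "real \<Rightarrow> real" where f: "Modules.additive f" "f 1 = 1" "range f \<subseteq> \<rat>"
    by (rule rational_retraction)
  have z: "\<And>x. x \<in> E \<Longrightarrow> (\<Sum>j<length As. incidence As x j * z j) = 1"
    using As(1) unfolding cover_solutions_def by blast
  have "(\<lambda>j\<in>{..<length As}. f (z j)) \<in> cover_solutions E As"
  proof -
    have "(\<Sum>j<length As. incidence As x j * f (z j)) = 1" if "x \<in> E" for x
    proof -
      have "(\<Sum>j<length As. incidence As x j * f (z j)) = (\<Sum>j<length As. f (incidence As x j * z j))"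
        by (intro sum.cong) (auto simp: incidence_def Modules.additive.zero[OF f(1)])
      also have "\<dots> = f (\<Sum>j<length As. incidence As x j * z j)"
        by (rule Modules.additive.sum[OF f(1), symmetric])
      finally show ?thesis
        using z[OF that] f(2) by simp
    qed
    then show ?thesis
      by (simp add: cover_solutions_def)
  qed
  then have eq: "z = (\<lambda>j\<in>{..<length As}. f (z j))"
    using As(1) by simp
  have "z j \<in> \<rat>" if "j < length As" for j
  proof -
    have "z j = f (z j)"
      using fun_cong[OF eq, of j] that by simp
    then show ?thesis
      using f(3) by (metis rangeI subsetD)
  qed
  then have "\<pi> A \<in> \<rat>" if "A \<in> nonempty_subsets E" for A
    using As(2) that unfolding corresponds_to_def by (metis in_set_conv_nth Rats_0)
  then show ?thesis
    using assms by (simp add: rational_CAR_def extreme_CAR_def)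
qed

subsection \<open>Mixtures\<close>

definition convex_comb :: "'a set \<Rightarrow> real \<Rightarrow> ('a set \<Rightarrow> real) \<Rightarrow> ('a set \<Rightarrow> real) \<Rightarrow> 'a set \<Rightarrow> real" where
  "convex_comb E u a b = (\<lambda>A\<in>nonempty_subsets E. u * a A + (1 - u) * b A)"

text \<open>The convex hull of the extreme mechanisms, built from binary combinations. The nested
  form fits both inductions: reducing the support splits a mechanism into two, and rational
  approximation rounds one weight at a time.\<close>

inductive extreme_mixture :: "'a set \<Rightarrow> ('a set \<Rightarrow> real) \<Rightarrow> bool" for E where
  extreme: "extreme_CAR E \<pi> \<Longrightarrow> extreme_mixture E \<pi>"
| comb: "\<lbrakk>extreme_mixture E a; extreme_mixture E b; 0 \<le> u; u \<le> 1\<rbrakk> \<Longrightarrow>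
    extreme_mixture E (convex_comb E u a b)"

lemma CAR_mechanism_convex_comb:
  assumes "CAR_mechanism E a" "CAR_mechanism E b" "0 \<le> u" "u \<le> 1"
  shows "CAR_mechanism E (convex_comb E u a b)"
proof -
  have "(\<Sum>A | A \<in> nonempty_subsets E \<and> x \<in> A. convex_comb E u a b A) = 1" if "x \<in> E" for x
  proof -
    have "(\<Sum>A | A \<in> nonempty_subsets E \<and> x \<in> A. convex_comb E u a b A) =
        u * (\<Sum>A | A \<in> nonempty_subsets E \<and> x \<in> A. a A) +
        (1 - u) * (\<Sum>A | A \<in> nonempty_subsets E \<and> x \<in> A. b A)"
      by (simp add: convex_comb_def sum.distrib sum_distrib_left)
    then show ?thesis
      using assms that by (simp add: CAR_mechanism_def)
  qed
  then show ?thesis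
    using assms by (simp add: CAR_mechanism_def convex_comb_def)
qed

lemma extreme_mixture_imp_CAR: "extreme_mixture E \<pi> \<Longrightarrow> CAR_mechanism E \<pi>"
  by (induction rule: extreme_mixture.induct) (auto simp: extreme_CAR_def intro: CAR_mechanism_convex_comb)

section \<open>Decomposition by shrinking the support\<close>

text \<open>Moving along \<open>d\<close> preserves all sums and creates no new support. Going as
  far as nonnegativity permits makes some positive coordinate reach 0.\<close>

lemma CAR_mechanism_shift_smaller_support:
  assumes "finite E" and car: "CAR_mechanism E \<pi>"
    and d: "\<And>x. x \<in> E \<Longrightarrow> (\<Sum>A | A \<in> nonempty_subsets E \<and> x \<in> A. d A) = 0"
    and supp: "\<And>A. \<pi> A = 0 \<Longrightarrow> d A = 0"
    and A0: "A0 \<in> nonempty_subsets E" "d A0 \<noteq> 0"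
  obtains t where "0 < t"
    "CAR_mechanism E (\<lambda>A\<in>nonempty_subsets E. \<pi> A + t * d A)"
    "card {A \<in> nonempty_subsets E. \<pi> A + t * d A \<noteq> 0} < card {A \<in> nonempty_subsets E. \<pi> A \<noteq> 0}"
proof -
  define N where "N = {A \<in> nonempty_subsets E. d A < 0}"
  have fin: "finite (nonempty_subsets E)" "finite N"
    using finite_nonempty_subsets[OF assms(1)] by (auto simp: N_def)
  have nonneg: "0 \<le> \<pi> A" if "A \<in> nonempty_subsets E" for A
    using car that by (simp add: CAR_mechanism_def)
  \<comment> \<open>If \<open>d\<close> were nonnegative, its zero sum at a point \<open>x\<close>
    of \<open>A0\<close> would force \<open>d A0 = 0\<close>.\<close>
  have "N \<noteq> {}"
  proof
    assume "N = {}"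
    then have ge: "0 \<le> d A" if "A \<in> nonempty_subsets E" for A
      using that by (force simp: N_def)
    obtain x where x: "x \<in> A0" "x \<in> E"
      using A0 by (auto simp: nonempty_subsets_def)
    have "\<forall>A\<in>{A. A \<in> nonempty_subsets E \<and> x \<in> A}. d A = 0"
      using d[OF x(2)] fin(1) ge by (subst (asm) sum_nonneg_eq_0_iff) auto
    then show False
      using A0 x by auto
  qed
  \<comment> \<open>The ratio test of the simplex method: \<open>t\<close> is the largest admissible
    step, and a minimizing set \<open>B\<close> is one whose coordinate vanishes. It is positive
    because \<open>d\<close> is 0 wherever \<open>\<pi>\<close> is.\<close>
  define t where "t = Min ((\<lambda>A. \<pi> A / - d A) ` N)"
  have "t \<in> (\<lambda>A. \<pi> A / - d A) ` N"
    unfolding t_def using fin \<open>N \<noteq> {}\<close> by (intro Min_in) auto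
  then obtain B where B: "B \<in> N" "t = \<pi> B / - d B"
    by blast
  have "\<pi> B \<noteq> 0"
    using B supp by (force simp: N_def)
  moreover have "0 \<le> \<pi> B"
    using B nonneg by (simp add: N_def)
  ultimately have "0 < \<pi> B"
    by simp
  have "d B < 0"
    using B by (simp add: N_def)
  have "0 < t"
    using \<open>0 < \<pi> B\<close> \<open>d B < 0\<close> by (simp add: B field_simps)
  have ge: "0 \<le> \<pi> A + t * d A" if A: "A \<in> nonempty_subsets E" for A
  proof (cases "d A < 0")
    case True
    then have "t \<le> \<pi> A / - d A"
      unfolding t_def using fin A by (intro Min_le) (auto simp: N_def)
    then show ?thesis
      using True by (simp add: field_simps)
  next
    case False
    then show ?thesis
      using nonneg[OF A] \<open>0 < t\<close> by simp
  qed
  show ?thesis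
  proof
    show "0 < t" by fact
    show "CAR_mechanism E (\<lambda>A\<in>nonempty_subsets E. \<pi> A + t * d A)"
      using car d ge by (simp add: CAR_mechanism_def sum.distrib flip: sum_distrib_left)
    have "{A \<in> nonempty_subsets E. \<pi> A + t * d A \<noteq> 0} \<subset> {A \<in> nonempty_subsets E. \<pi> A \<noteq> 0}"
    proof
      show "{A \<in> nonempty_subsets E. \<pi> A + t * d A \<noteq> 0} \<subseteq> {A \<in> nonempty_subsets E. \<pi> A \<noteq> 0}"
        using supp by force
      have "B \<in> {A \<in> nonempty_subsets E. \<pi> A \<noteq> 0}" "B \<notin> {A \<in> nonempty_subsets E. \<pi> A + t * d A \<noteq> 0}"
        using B \<open>0 < \<pi> B\<close> \<open>d B < 0\<close> by (auto simp: N_def)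
      then show "{A \<in> nonempty_subsets E. \<pi> A + t * d A \<noteq> 0} \<noteq> {A \<in> nonempty_subsets E. \<pi> A \<noteq> 0}"
        by blast
    qed
    then show "card {A \<in> nonempty_subsets E. \<pi> A + t * d A \<noteq> 0} <
        card {A \<in> nonempty_subsets E. \<pi> A \<noteq> 0}"
      using fin(1) by (intro psubset_card_mono) auto
  qed
qed

lemma CAR_mechanism_imp_extreme_mixture:
  assumes "finite E" "CAR_mechanism E \<pi>"
  shows "extreme_mixture E \<pi>"
  using assms(2)
proof (induction "card {A \<in> nonempty_subsets E. \<pi> A \<noteq> 0}" arbitrary: \<pi> rule: less_induct)
  case less
  show ?case
  proof (cases "extreme_CAR E \<pi>")
    case True
    then show ?thesis by (rule extreme)
  next
    case False
    then obtain d A0 where d: "\<And>x. x \<in> E \<Longrightarrow> (\<Sum>A | A \<in> nonempty_subsets E \<and> x \<in> A. d A) = 0"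
      and supp: "\<And>A. \<pi> A = 0 \<Longrightarrow> d A = 0"
      and A0: "A0 \<in> nonempty_subsets E" "d A0 \<noteq> (0::real)"
      using extreme_CAR_if_trivial_kernel[OF assms(1) less.prems] by blast
    obtain t where t: "0 < t" "CAR_mechanism E (\<lambda>A\<in>nonempty_subsets E. \<pi> A + t * d A)"
      "card {A \<in> nonempty_subsets E. \<pi> A + t * d A \<noteq> 0} < card {A \<in> nonempty_subsets E. \<pi> A \<noteq> 0}"
      using CAR_mechanism_shift_smaller_support[OF assms(1) less.prems d supp A0] by blast
    \<comment> \<open>The conditions on \<open>d\<close> are symmetric under negation, so the same
      shift works in the opposite direction, with its own step length.\<close>
    obtain s where s: "0 < s" "CAR_mechanism E (\<lambda>A\<in>nonempty_subsets E. \<pi> A + s * - d A)"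
      "card {A \<in> nonempty_subsets E. \<pi> A + s * - d A \<noteq> 0} < card {A \<in> nonempty_subsets E. \<pi> A \<noteq> 0}"
      by (rule CAR_mechanism_shift_smaller_support[OF assms(1) less.prems, of "\<lambda>A. - d A" A0])
        (use d supp A0 in \<open>auto simp: sum_negf\<close>)
    let ?a = "\<lambda>A\<in>nonempty_subsets E. \<pi> A + t * d A"
    let ?b = "\<lambda>A\<in>nonempty_subsets E. \<pi> A + s * - d A"
    have "extreme_mixture E ?a" "extreme_mixture E ?b"
      using t s by (auto intro!: less.hyps cong: conj_cong)
    then have "extreme_mixture E (convex_comb E (s / (s + t)) ?a ?b)"
      using s t by (intro comb) auto
    moreover have "\<pi> = convex_comb E (s / (s + t)) ?a ?b"
    proof
      fix A
      have "\<pi> A = s / (s + t) * (\<pi> A + t * d A) + (1 - s / (s + t)) * (\<pi> A + s * - d A)"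
        using s(1) t(1) by (simp add: divide_simps) (simp add: algebra_simps)
      then show "\<pi> A = convex_comb E (s / (s + t)) ?a ?b A"
        using less.prems by (auto simp: convex_comb_def CAR_mechanism_def PiE_def extensional_def)
    qed
    ultimately show ?thesis by simp
  qed
qed

section \<open>Flattening nested mixtures\<close>

lemma extreme_mixture_imp_sum:
  assumes "extreme_mixture E \<pi>"
  shows "\<exists>(p::nat) (\<rho> :: nat \<Rightarrow> 'a set \<Rightarrow> real) (c :: nat \<Rightarrow> real).
    1 \<le> p \<and> (\<forall>i\<in>{1..p}. extreme_CAR E (\<rho> i)) \<and> (\<forall>i\<in>{1..p}. 0 \<le> c i) \<and> (\<Sum>i=1..p. c i) = 1 \<and>
    \<pi> = (\<lambda>A\<in>nonempty_subsets E. \<Sum>i=1..p. c i * \<rho> i A)"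
  using assms
proof (induction rule: extreme_mixture.induct)
  case (extreme \<pi>)
  then have "\<pi> = (\<lambda>A\<in>nonempty_subsets E. \<pi> A)"
    by (auto simp: extreme_CAR_def CAR_mechanism_def PiE_def extensional_restrict)
  then show ?case
    using extreme by (intro exI[of _ 1] exI[of _ "\<lambda>_. \<pi>"] exI[of _ "\<lambda>_. 1"]) simp
next
  case (comb a b u)
  obtain p :: nat and \<rho> c where a: "1 \<le> p" "\<forall>i\<in>{1..p}. extreme_CAR E (\<rho> i)"
    "\<forall>i\<in>{1..p}. 0 \<le> c i" "(\<Sum>i=1..p. c i) = 1"
    "a = (\<lambda>A\<in>nonempty_subsets E. \<Sum>i=1..p. c i * \<rho> i A)" using comb.IH(1) by blast
  obtain q :: nat and \<sigma> e where b: "1 \<le> q" "\<forall>i\<in>{1..q}. extreme_CAR E (\<sigma> i)"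
    "\<forall>i\<in>{1..q}. 0 \<le> e i" "(\<Sum>i=1..q. e i) = 1"
    "b = (\<lambda>A\<in>nonempty_subsets E. \<Sum>i=1..q. e i * \<sigma> i A)" using comb.IH(2) by blast
  \<comment> \<open>Concatenation: indices 1 to \<open>p\<close> carry the first mixture with
    weights scaled by \<open>u\<close>, indices \<open>p + 1\<close> to \<open>p + q\<close> the
    second with weights scaled by \<open>1 - u\<close>.\<close>
  define \<tau> where "\<tau> i = (if i \<le> p then \<rho> i else \<sigma> (i - p))" for i
  define w where "w i = (if i \<le> p then u * c i else (1 - u) * e (i - p))" for i
  have split: "(\<Sum>i=1..p+q. h i) = (\<Sum>i=1..p. h i) + (\<Sum>i=1..q. h (i + p))" for h :: "nat \<Rightarrow> real"
    using sum.ub_add_nat[of 1 p h q] sum.shift_bounds_cl_nat_ivl[of h 1 p q] by (simp add: add.commute)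
  have shift: "\<tau> (i + p) = \<sigma> i" "w (i + p) = (1 - u) * e i" if "i \<in> {1..q}" for i
    using that by (auto simp: \<tau>_def w_def)
  have low: "\<tau> i = \<rho> i" "w i = u * c i" if "i \<in> {1..p}" for i
    using that by (auto simp: \<tau>_def w_def)
  have cases: "i \<in> {1..p} \<or> i - p \<in> {1..q} \<and> \<not> i \<le> p" if "i \<in> {1..p+q}" for i
    using that by auto
  have "extreme_CAR E (\<tau> i)" if "i \<in> {1..p+q}" for i
    using cases[OF that] a(2) b(2) by (auto simp: \<tau>_def)
  moreover have "0 \<le> w i" if "i \<in> {1..p+q}" for i
    using cases[OF that] a(3) b(3) comb.hyps by (auto simp: w_def)
  moreover have "(\<Sum>i=1..p+q. w i) = u * (\<Sum>i=1..p. c i) + (1 - u) * (\<Sum>i=1..q. e i)"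
    unfolding split sum_distrib_left by (intro arg_cong2[of _ _ _ _ "(+)"] sum.cong) (simp_all add: low shift)
  moreover have "convex_comb E u a b = (\<lambda>A\<in>nonempty_subsets E. \<Sum>i=1..p+q. w i * \<tau> i A)"
  proof -
    have "(\<Sum>i=1..p+q. w i * \<tau> i A) =
        u * (\<Sum>i=1..p. c i * \<rho> i A) + (1 - u) * (\<Sum>i=1..q. e i * \<sigma> i A)" for A
      unfolding split sum_distrib_left
      by (intro arg_cong2[of _ _ _ _ "(+)"] sum.cong) (simp_all add: low shift mult.assoc)
    then show ?thesis
      unfolding convex_comb_def a(5) b(5) by (auto simp: restrict_def)
  qed
  ultimately show ?case
    using a b by (intro exI[of _ "p + q"] exI[of _ \<tau>] exI[of _ w]) simp
qed

subsection \<open>Rational approximation\<close>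

lemma CAR_mechanism_le_1:
  assumes "finite E" "CAR_mechanism E \<pi>" "A \<in> nonempty_subsets E"
  shows "\<pi> A \<le> 1"
proof -
  obtain x where x: "x \<in> A" "x \<in> E"
    using assms(3) by (auto simp: nonempty_subsets_def)
  have "\<pi> A \<le> (\<Sum>A | A \<in> nonempty_subsets E \<and> x \<in> A. \<pi> A)"
    using assms x finite_nonempty_subsets[OF assms(1)]
    by (intro member_le_sum) (auto simp: CAR_mechanism_def)
  then show ?thesis
    using assms x by (simp add: CAR_mechanism_def)
qed

lemma rational_approx_unit_interval:
  fixes u \<epsilon> :: real
  assumes "0 \<le> u" "u \<le> 1" "0 < \<epsilon>"
  obtains v where "v \<in> \<rat>" "0 \<le> v" "v \<le> 1" "\<bar>u - v\<bar> < \<epsilon>"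
proof (cases "u = 0")
  case True
  then show ?thesis
    using assms that[of 0] by simp
next
  case False
  \<comment> \<open>Approximating from below keeps \<open>v \<le> 1\<close>, and cutting the lower
    end at 0 keeps \<open>v\<close> nonnegative. The open interval is nonempty because
    \<open>u\<close> is positive here.\<close>
  then obtain v where "v \<in> \<rat>" "max 0 (u - \<epsilon>) < v" "v < u"
    using assms Rats_dense_in_real[of "max 0 (u - \<epsilon>)" u] by auto
  then show ?thesis
    using assms that[of v] by simp
qed

text \<open>Combining rational mechanisms with a rational weight stays rational. Half of
  \<open>\<epsilon>\<close> pays for rounding the weight, the other half for approximating the two
  components.\<close>

lemma extreme_mixture_rational_approx:
  assumes "finite E" "extreme_mixture E \<pi>" "0 < \<epsilon>"
  shows "\<exists>\<pi>'. rational_CAR E \<pi>' \<and> (\<forall>A\<in>nonempty_subsets E. \<bar>\<pi> A - \<pi>' A\<bar> < \<epsilon>)"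
  using assms(2,3)
proof (induction arbitrary: \<epsilon> rule: extreme_mixture.induct)
  case (extreme \<pi>)
  then show ?case
    using extreme_CAR_imp_rational by (intro exI[of _ \<pi>]) simp
next
  case (comb a b u)
  then have "0 < \<epsilon> / 2" by simp
  obtain a' where a': "rational_CAR E a'" "\<forall>A\<in>nonempty_subsets E. \<bar>a A - a' A\<bar> < \<epsilon> / 2"
    using comb.IH(1) \<open>0 < \<epsilon> / 2\<close> by blast
  obtain b' where b': "rational_CAR E b'" "\<forall>A\<in>nonempty_subsets E. \<bar>b A - b' A\<bar> < \<epsilon> / 2"
    using comb.IH(2) \<open>0 < \<epsilon> / 2\<close> by blast
  obtain v where v: "v \<in> \<rat>" "0 \<le> v" "v \<le> 1" "\<bar>u - v\<bar> < \<epsilon> / 2"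
    using rational_approx_unit_interval comb.hyps \<open>0 < \<epsilon> / 2\<close> by metis
  have "rational_CAR E (convex_comb E v a' b')"
    using a'(1) b'(1) v CAR_mechanism_convex_comb[of E a' b' v]
    by (simp add: rational_CAR_def) (simp add: convex_comb_def)
  moreover have "\<bar>convex_comb E u a b A - convex_comb E v a' b' A\<bar> < \<epsilon>" if A: "A \<in> nonempty_subsets E" for A
  proof -
    have car: "CAR_mechanism E a" "CAR_mechanism E b"
      using comb.hyps extreme_mixture_imp_CAR by blast+
    then have "a A \<le> 1" "b A \<le> 1"
      using A CAR_mechanism_le_1[OF assms(1)] by blast+
    moreover have "0 \<le> a A" "0 \<le> b A"
      using car A by (auto simp: CAR_mechanism_def)
    \<comment> \<open>Both values lie in the unit interval, so an error in the weight is not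
      magnified.\<close>
    ultimately have "\<bar>a A - b A\<bar> \<le> 1" by linarith
    then have 1: "\<bar>u - v\<bar> * \<bar>a A - b A\<bar> \<le> \<bar>u - v\<bar>"
      by (simp add: mult_left_le)
    have 2: "v * \<bar>a A - a' A\<bar> \<le> v * (\<epsilon> / 2)" "(1 - v) * \<bar>b A - b' A\<bar> \<le> (1 - v) * (\<epsilon> / 2)"
      using mult_left_mono[OF less_imp_le[OF bspec[OF a'(2) A]], of v]
        mult_left_mono[OF less_imp_le[OF bspec[OF b'(2) A]], of "1 - v"] v by auto
    \<comment> \<open>First exchange the weight \<open>u\<close> for \<open>v\<close> with
      \<open>a\<close> and \<open>b\<close> kept, then exchange the components under the weight
      \<open>v\<close>.\<close>
    have "convex_comb E u a b A - convex_comb E v a' b' A =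
        (u - v) * (a A - b A) + v * (a A - a' A) + (1 - v) * (b A - b' A)"
      using A by (simp add: convex_comb_def algebra_simps)
    also have "\<bar>\<dots>\<bar> \<le> \<bar>u - v\<bar> * \<bar>a A - b A\<bar> + v * \<bar>a A - a' A\<bar> + (1 - v) * \<bar>b A - b' A\<bar>"
      using v by (intro order.trans[OF abs_triangle_ineq] add_mono) (auto simp: abs_mult)
    also have "\<dots> \<le> \<bar>u - v\<bar> + (v * (\<epsilon> / 2) + (1 - v) * (\<epsilon> / 2))"
      using 1 2 by linarith
    also have "\<dots> = \<bar>u - v\<bar> + \<epsilon> / 2"
      by (simp flip: distrib_right)
    finally show ?thesis
      using v(4) by linarith
  qed
  ultimately show ?case by blast
qed

lemma CAR_mechanism_rational_approx:
  assumes "finite E" "CAR_mechanism E \<pi>" "0 < \<epsilon>"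
  shows "\<exists>\<pi>'. rational_CAR E \<pi>' \<and> L2_set (\<lambda>A. \<pi> A - \<pi>' A) (nonempty_subsets E) < \<epsilon>"
proof -
  let ?n = "real (card (nonempty_subsets E))"
  \<comment> \<open>The Euclidean norm is at most the sum of the \<open>?n\<close> absolute values,
    so this tolerance per coordinate suffices; the added 1 makes the final inequality
    strict.\<close>
  have "0 < \<epsilon> / (?n + 1)"
    using assms(3) by (simp add: add_nonneg_pos)
  then obtain \<pi>' where \<pi>': "rational_CAR E \<pi>'"
    "\<And>A. A \<in> nonempty_subsets E \<Longrightarrow> \<bar>\<pi> A - \<pi>' A\<bar> < \<epsilon> / (?n + 1)"
    using extreme_mixture_rational_approx[OF assms(1) CAR_mechanism_imp_extreme_mixture[OF assms(1,2)]]
    by blast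
  have "L2_set (\<lambda>A. \<pi> A - \<pi>' A) (nonempty_subsets E) \<le> (\<Sum>A\<in>nonempty_subsets E. \<bar>\<pi> A - \<pi>' A\<bar>)"
    by (rule L2_set_le_sum_abs)
  also have "\<dots> \<le> ?n * (\<epsilon> / (?n + 1))"
    using \<pi>'(2) by (intro sum_bounded_above) (auto intro: less_imp_le)
  also have "\<dots> < \<epsilon>"
    using assms(3) by (simp add: field_simps add_nonneg_pos)
  finally show ?thesis
    using \<pi>'(1) by blast
qed

theorem theorem2:
  fixes E :: "'a set"
  assumes "finite E" and "E \<noteq> {}"
  shows "(\<forall>\<pi> \<epsilon>. CAR_mechanism E \<pi> \<and> 0 < \<epsilon> \<longrightarrow>
            (\<exists>\<pi>'. rational_CAR E \<pi>' \<and>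
               L2_set (\<lambda>A. \<pi> A - \<pi>' A) (nonempty_subsets E) < \<epsilon>)) \<and>
         (\<forall>\<pi>. extreme_CAR E \<pi> \<longrightarrow> rational_CAR E \<pi>) \<and>
         (\<forall>\<pi>. CAR_mechanism E \<pi> \<longrightarrow>
            (\<exists>(p::nat) (\<rho> :: nat \<Rightarrow> 'a set \<Rightarrow> real) (c :: nat \<Rightarrow> real).
               1 \<le> p \<and>
               (\<forall>i\<in>{1..p}. extreme_CAR E (\<rho> i)) \<and>
               (\<forall>i\<in>{1..p}. 0 \<le> c i) \<and> (\<Sum>i=1..p. c i) = 1 \<and>
               \<pi> = (\<lambda>A\<in>nonempty_subsets E. \<Sum>i=1..p. c i * \<rho> i A)))"
proof (intro conjI allI impI; (elim conjE)?)
  fix \<pi> :: "'a set \<Rightarrow> real" and \<epsilon> :: real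
  assume "CAR_mechanism E \<pi>" "0 < \<epsilon>"
  then show "\<exists>\<pi>'. rational_CAR E \<pi>' \<and> L2_set (\<lambda>A. \<pi> A - \<pi>' A) (nonempty_subsets E) < \<epsilon>"
    by (rule CAR_mechanism_rational_approx[OF assms(1)])
qed (fact extreme_CAR_imp_rational
  extreme_mixture_imp_sum[OF CAR_mechanism_imp_extreme_mixture[OF assms(1)]])+

end
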